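(* Let $q\ge 1$ and let $F=F_q\circ F_{q-1}\circ\dots\circ F_1$ with differentiable $F_i:\mathbb{R}^{n_i}\to\mathbb{R}^{m_i}$, $m_i=n_{i+1}$ for $1\le i<q$, where all local Jacobians $F'_i\in\mathbb{R}^{m_i\times n_i}$ are regarded as dense, and where tangents and adjoints are available for every $F_i$. Let $G_i=(V_i,E_i)$ be the directed acyclic graph of $F_i$, so that evaluating the tangent (adjoint) of $F_i$ for a matrix with $c$ columns (rows) costs $c\cdot|E_i|$ fused multiply-add operations. Then the problem Generalized Dense Jacobian Chain Product Bracketing is solved by dynamic programming as follows. For $1\le i\le j\le q$ let $\mathrm{fma}_{j,i}$ be the minimum, over all admissible evaluations, of the number of fused multiply-add operations required to accumulate the Jacobian $F'_{j,i}=F'_j\cdot F'_{j-1}\cdots F'_i$ of the subchain $F_j\circ\dots\circ F_i$. Then $$ \mathrm{fma}_{j,i}= \begin{cases} |E_j|\cdot\min\{n_j,m_j\} & \text{if } j=i,\\[1ex] \displaystyle\min_{i\le k<j}\ \min\left\{ \begin{array}{l} \mathrm{fma}_{j,k+1}+\mathrm{fma}_{k,i}+m_j\cdot m_k\cdot n_i,\\[0.5ex] \mathrm{fma}_{j,k+1}+m_j\cdot\sum_{\nu=i}^{k}|E_\nu|,\\[0.5ex] \mathrm{fma}_{k,i}+n_i\cdot\sum_{\nu=k+1}^{j}|E_\nu| \end{array}\right\} & \text{if } j>i . \end{cases} $$ In particular, the value $\mathrm{fma}_{q,1}$ obtained by tabulating this recurrence in order of increasing $j-i$ is the minimum number of fused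 multiply-add operations required for the accumulation of the full Jacobian $F'=F'_{q,1}$.
   Context: Setting. $F=F_q\circ\dots\circ F_1$, with Jacobian $F'=F'_q\cdot F'_{q-1}\cdots F'_1$ by the chain rule. Each $F_i:\mathbb{R}^{n_i}\to\mathbb{R}^{m_i}$ comes with a directed acyclic graph $G_i=(V_i,E_i)$ whose vertices are the elemental arithmetic operations in the evaluation of $F_i$ and whose edges are data dependencies labeled with local partial derivatives. For the purposes of this result only the positive integers $n_i,m_i,|E_i|$ matter. Special structure of the graphs (e.g. bipartiteness) and sparsity of Jacobians are not exploited. Memory is unconstrained. The cost of evaluating $F$ itself and the local partial derivatives is invariant and not counted. Cost is counted in fused multiply-add (fma) operations. For $i\le j$ write $F'_{j,i}=F'_j\cdots F'_i\in\mathbb{R}^{m_j\times n_i}$, so $F'_{i,i}=F'_i$. $I_n$ denotes the $n\times n$ identity. Tangent of $F_i$: given a matrix $\dot Z\in\mathbb{R}^{n_i\times c}$, it returns $F'_i\cdot\dot Z$ without forming $F'_i$, at cost $c\cdot|E_i|$. Adjoint of $F_i$: given $\bar Z\in\mathbb{R}^{c\times m_i}$, it returns $\bar Z\cdot F'_i$ without forming $F'_i$, at cost $c\cdot|E_i|$. Admissible evaluations (Generalized Dense Jacobian Chain Product Bracketing). An admissible evaluation accumulates $F'_{j,i}$ through a finite composition of the following elementary steps, its cost being the sum of the costs of the steps: (1) accumulate $F'_i$ as the tangent of $F_i$ applied to $I_{n_i}$, at cost $n_i|E_i|$; (2) accumulate $F'_i$ as the adjoint of $F_i$ applied to $I_{m_i}$,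 at cost $m_i|E_i|$; (3) from an available $F'_{k,i}$ with $k<q$, obtain $F'_{k+1,i}$ as the tangent of $F_{k+1}$ applied to $F'_{k,i}$, at cost $n_i|E_{k+1}|$; (4) from an available $F'_{j,k+1}$ with $k\ge 1$, obtain $F'_{j,k}$ as the adjoint of $F_k$ applied to $F'_{j,k+1}$, at cost $m_j|E_k|$; (5) from available $F'_{j,k+1}$ and $F'_{k,i}$ with $i\le k<j$, obtain $F'_{j,i}$ as the dense matrix product $F'_{j,k+1}\cdot F'_{k,i}$, at cost $m_j\cdot m_k\cdot n_i$. The tangent (adjoint) of a subchain $F_j\circ\dots\circ F_{k+1}$ (resp. $F_k\circ\dots\circ F_i$) is the successive application of steps (3) (resp. (4)), with cost $n_i\sum_{\nu=k+1}^j|E_\nu|$ (resp. $m_j\sum_{\nu=i}^k|E_\nu|$). The decision version of the problem asks, for a given positive integer $K$, whether there is an admissible evaluation of $F'$ with cost below $K$; a solution is an evaluation of minimum cost. *)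

theory Defs
  imports
    "HOL-Analysis.Derivative"
    "Jordan_Normal_Form.Matrix"
    "Graph_Theory.Pair_Digraph"
begin

text \<open>
  The dimensions vary along the chain, so \<open>\<real>\<^sup>n\<close> is \<open>carrier_vec n :: real vec set\<close> and
  differentiability has to be spelled out for this carrier.
\<close>

definition eucl_norm :: "real vec \<Rightarrow> real" where
  "eucl_norm v = sqrt (v \<bullet> v)"

definition vec_differentiable_at ::
    "nat \<Rightarrow> nat \<Rightarrow> (real vec \<Rightarrow> real vec) \<Rightarrow> real vec \<Rightarrow> bool" where
  "vec_differentiable_at n m f x \<longleftrightarrow>
     (\<exists>A \<in> carrier_mat m n. \<forall>\<epsilon>>0. \<exists>\<delta>>0. \<forall>y \<in> carrier_vec n.
        eucl_norm (y - x) < \<delta> \<longrightarrow>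
        eucl_norm (f y - f x - A *\<^sub>v (y - x)) \<le> \<epsilon> * eucl_norm (y - x))"

definition jacobian :: "nat \<Rightarrow> nat \<Rightarrow> (real vec \<Rightarrow> real vec) \<Rightarrow> real vec \<Rightarrow> real mat" where
  "jacobian n m f x =
     mat m n (\<lambda>(r, c). deriv (\<lambda>t. vec_index (f (x + t \<cdot>\<^sub>v unit_vec n c)) r) 0)"

text \<open>\<open>chain_map F k\<close> is \<open>F\<^sub>k \<circ> \<dots> \<circ> F\<^sub>1\<close>.\<close>

primrec chain_map :: "(nat \<Rightarrow> 'a \<Rightarrow> 'a) \<Rightarrow> nat \<Rightarrow> 'a \<Rightarrow> 'a" where
  "chain_map F 0 = id"
| "chain_map F (Suc k) = F (Suc k) \<circ> chain_map F k"

text \<open>\<open>F'\<^sub>i\<close> is taken at the point that \<open>F\<^sub>i\<close> receives when the chain is evaluated at \<open>x\<close>.\<close>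

definition local_jacobian ::
    "(nat \<Rightarrow> nat) \<Rightarrow> (nat \<Rightarrow> nat) \<Rightarrow> (nat \<Rightarrow> real vec \<Rightarrow> real vec) \<Rightarrow> real vec \<Rightarrow> nat \<Rightarrow> real mat" where
  "local_jacobian n m F x i = jacobian (n i) (m i) (F i) (chain_map F (i - 1) x)"

text \<open>\<open>chain_jacobian J j i\<close> is \<open>F'\<^sub>j\<^sub>,\<^sub>i = F'\<^sub>j \<cdots> F'\<^sub>i\<close> for \<open>i \<le> j\<close>, where \<open>J i\<close> is \<open>F'\<^sub>i\<close>.\<close>

fun chain_jacobian :: "(nat \<Rightarrow> real mat) \<Rightarrow> nat \<Rightarrow> nat \<Rightarrow> real mat" where
  "chain_jacobian J j i = (if j \<le> i then J j else J j * chain_jacobian J (j - 1) i)"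

declare chain_jacobian.simps [simp del]

definition tangent :: "(nat \<Rightarrow> real mat) \<Rightarrow> nat \<Rightarrow> real mat \<Rightarrow> real mat" where
  "tangent J i Z = J i * Z"

definition adjoint :: "(nat \<Rightarrow> real mat) \<Rightarrow> nat \<Rightarrow> real mat \<Rightarrow> real mat" where
  "adjoint J i Z = Z * J i"

text \<open>
  A store records at \<open>(j, i)\<close> the matrix accumulated for \<open>F'\<^sub>j\<^sub>,\<^sub>i\<close>, if any. Memory is unconstrained:
  what is available stays available and may be used again by any number of later steps.
  \<open>eval_step q n m e J s c s'\<close> is an elementary step of cost \<open>c\<close>; \<open>e i\<close> is the number of edges
  of the graph of \<open>F\<^sub>i\<close>.
\<close>

type_synonym store = "nat \<times> nat \<Rightarrow> real mat option"

inductive eval_step ::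
    "nat \<Rightarrow> (nat \<Rightarrow> nat) \<Rightarrow> (nat \<Rightarrow> nat) \<Rightarrow> (nat \<Rightarrow> nat) \<Rightarrow> (nat \<Rightarrow> real mat)
      \<Rightarrow> store \<Rightarrow> nat \<Rightarrow> store \<Rightarrow> bool"
  for q n m e J where
  tangent_identity:
    "\<lbrakk>1 \<le> i; i \<le> q\<rbrakk>
      \<Longrightarrow> eval_step q n m e J s (n i * e i) (s((i, i) \<mapsto> tangent J i (1\<^sub>m (n i))))"
| adjoint_identity:
    "\<lbrakk>1 \<le> i; i \<le> q\<rbrakk>
      \<Longrightarrow> eval_step q n m e J s (m i * e i) (s((i, i) \<mapsto> adjoint J i (1\<^sub>m (m i))))"
| tangent_extend:
    "\<lbrakk>s (k, i) = Some A; k < q\<rbrakk>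
      \<Longrightarrow> eval_step q n m e J s (n i * e (k + 1)) (s((k + 1, i) \<mapsto> tangent J (k + 1) A))"
| adjoint_extend:
    "\<lbrakk>s (j, k + 1) = Some A; 1 \<le> k\<rbrakk>
      \<Longrightarrow> eval_step q n m e J s (m j * e k) (s((j, k) \<mapsto> adjoint J k A))"
| dense_product:
    "\<lbrakk>s (j, k + 1) = Some A; s (k, i) = Some B; i \<le> k; k < j\<rbrakk>
      \<Longrightarrow> eval_step q n m e J s (m j * m k * n i) (s((j, i) \<mapsto> A * B))"

inductive evaluation ::
    "nat \<Rightarrow> (nat \<Rightarrow> nat) \<Rightarrow> (nat \<Rightarrow> nat) \<Rightarrow> (nat \<Rightarrow> nat) \<Rightarrow> (nat \<Rightarrow> real mat)
      \<Rightarrow> nat \<Rightarrow> store \<Rightarrow> bool"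
  for q n m e J where
  start: "evaluation q n m e J 0 Map.empty"
| step: "\<lbrakk>evaluation q n m e J c s; eval_step q n m e J s d s'\<rbrakk>
      \<Longrightarrow> evaluation q n m e J (c + d) s'"

definition accumulates ::
    "nat \<Rightarrow> (nat \<Rightarrow> nat) \<Rightarrow> (nat \<Rightarrow> nat) \<Rightarrow> (nat \<Rightarrow> nat) \<Rightarrow> (nat \<Rightarrow> real mat)
      \<Rightarrow> nat \<Rightarrow> nat \<Rightarrow> nat \<Rightarrow> real mat \<Rightarrow> bool" where
  "accumulates q n m e J c j i A \<longleftrightarrow> (\<exists>s. evaluation q n m e J c s \<and> s (j, i) = Some A)"

definition fma ::
    "nat \<Rightarrow> (nat \<Rightarrow> nat) \<Rightarrow> (nat \<Rightarrow> nat) \<Rightarrow> (nat \<Rightarrow> nat) \<Rightarrow> (nat \<Rightarrow> real mat)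
      \<Rightarrow> nat \<Rightarrow> nat \<Rightarrow> nat" where
  "fma q n m e J j i = (LEAST c. accumulates q n m e J c j i (chain_jacobian J j i))"

text \<open>
  The table after the diagonals \<open>j - i = 0, \<dots>, d\<close> have been filled in; other entries hold the
  placeholder \<open>0\<close>, which is never read.
\<close>

primrec fma_table ::
    "(nat \<Rightarrow> nat) \<Rightarrow> (nat \<Rightarrow> nat) \<Rightarrow> (nat \<Rightarrow> nat) \<Rightarrow> nat \<Rightarrow> nat \<Rightarrow> nat \<Rightarrow> nat" where
  "fma_table n m e 0 = (\<lambda>j i. if j = i then e j * min (n j) (m j) else 0)"
| "fma_table n m e (Suc d) = (\<lambda>j i.
     if j = i + Suc d then
       (MIN k\<in>{i..<j}. Min
         {fma_table n m e d j (k + 1) + fma_table n m e d k i + m j * m k * n i,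
          fma_table n m e d j (k + 1) + m j * (\<Sum>\<nu>=i..k. e \<nu>),
          fma_table n m e d k i + n i * (\<Sum>\<nu>=k+1..j. e \<nu>)})
     else fma_table n m e d j i)"

end

theory Submission
  imports Defs "HOL-Analysis.L2_Norm"
begin

section \<open>The chain rule on \<open>carrier_vec\<close>\<close>

text \<open>The recurrence prices the cheapest bracketing tree, in which every subchain product is
  built afresh. An evaluation, however, may store products and use them several times. The proof
  shows that such reuse never pays, because the two operands of a dense product belong to disjoint
  subchains. The value given by the recurrence is called \<open>opt_cost\<close>, and two
  inequalities identify it with the minimum \<open>fma\<close>.

  Lower bound (\<open>eval_step_invariant\<close>): charge each step to the interval of indices of
  the product that it writes, and let \<open>W j i\<close> be the total charge of intervals inside
  \<open>{i..j}\<close>. Adjacent subchains share no such interval, so \<open>W\<close> is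
  superadditive. By induction along the evaluation, \<open>W j i\<close> is at least
  \<open>opt_cost j i\<close> whenever entry \<open>(j, i)\<close> is filled: the step that writes
  it is a branch of the recurrence, and its operands have been paid for inside the corresponding
  subchains. The total cost bounds every \<open>W j i\<close>.

  Upper bound (\<open>evaluation_opt_cost\<close>): by strong induction on \<open>j - i\<close>, a
  branch that attains the minimum is turned into actual steps appended to any given evaluation.

  Calculus enters in identifying the accumulated matrix. The chain rule
  \<open>has_vec_derivative_at_comp\<close> and the agreement of partial derivatives with the
  derivative matrix (\<open>jacobian_eq_derivative\<close>) show that the product of the local
  Jacobians is the Jacobian of the composed map.\<close>

lemma eucl_norm_eq_L2_set: "eucl_norm v = L2_set (vec_index v) {0..<dim_vec v}"
  by (simp add: eucl_norm_def L2_set_def scalar_prod_def power2_eq_square)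

lemma eucl_norm_nonneg [simp]: "0 \<le> eucl_norm v"
  by (simp add: eucl_norm_eq_L2_set)

lemma eucl_norm_add_le:
  assumes "v \<in> carrier_vec n" "w \<in> carrier_vec n"
  shows "eucl_norm (v + w) \<le> eucl_norm v + eucl_norm w"
proof -
  have "eucl_norm (v + w) = L2_set (\<lambda>i. vec_index v i + vec_index w i) {0..<n}"
    using assms by (auto simp: eucl_norm_eq_L2_set intro!: L2_set_cong)
  also have "\<dots> \<le> eucl_norm v + eucl_norm w"
    using L2_set_triangle_ineq[of "vec_index v" "vec_index w" "{0..<n}"] assms
    by (simp add: eucl_norm_eq_L2_set)
  finally show ?thesis .
qed

lemma abs_index_le_eucl_norm:
  assumes "v \<in> carrier_vec n" "i < n"
  shows "\<bar>vec_index v i\<bar> \<le> eucl_norm v"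
proof -
  have "\<bar>vec_index v i\<bar> \<le> L2_set (\<lambda>i. \<bar>vec_index v i\<bar>) {0..<n}"
    using assms by (intro member_le_L2_set) auto
  then show ?thesis
    using assms by (simp add: eucl_norm_eq_L2_set L2_set_def)
qed

lemma eucl_norm_smult_unit_vec:
  assumes "c < n"
  shows "eucl_norm (t \<cdot>\<^sub>v unit_vec n c) = \<bar>t\<bar>"
  using assms by (simp add: eucl_norm_def)

text \<open>A linear map is bounded: each coordinate of \<open>A *\<^sub>v v\<close> is at most the
  absolute row sum times the norm of \<open>v\<close>, and the norm of a vector is at most the sum
  of its absolute coordinates.\<close>

lemma eucl_norm_mult_mat_vec_le:
  assumes "A \<in> carrier_mat m n"
  obtains C where "0 < C" "\<And>v. v \<in> carrier_vec n \<Longrightarrow> eucl_norm (A *\<^sub>v v) \<le> C * eucl_norm v"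
proof
  \<comment> \<open>The summand 1 keeps \<open>C\<close> positive when \<open>A\<close> is zero or
    has no entries.\<close>
  define C where "C = 1 + (\<Sum>i\<in>{0..<m}. \<Sum>j\<in>{0..<n}. \<bar>A $$ (i, j)\<bar>)"
  show "0 < C"
    unfolding C_def by (smt (verit) abs_ge_zero sum_nonneg)
  fix v :: "real vec" assume v: "v \<in> carrier_vec n"
  have "eucl_norm (A *\<^sub>v v) \<le> (\<Sum>i\<in>{0..<m}. \<bar>vec_index (A *\<^sub>v v) i\<bar>)"
    using L2_set_le_sum_abs[of "vec_index (A *\<^sub>v v)" "{0..<m}"] assms
    by (simp add: eucl_norm_eq_L2_set)
  also have "\<dots> \<le> (\<Sum>i\<in>{0..<m}. (\<Sum>j\<in>{0..<n}. \<bar>A $$ (i, j)\<bar>) * eucl_norm v)"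
  proof (rule sum_mono)
    fix i assume i: "i \<in> {0..<m}"
    have "vec_index (A *\<^sub>v v) i = (\<Sum>j\<in>{0..<n}. A $$ (i, j) * vec_index v j)"
      using i v assms by (auto simp: scalar_prod_def intro!: sum.cong)
    then have "\<bar>vec_index (A *\<^sub>v v) i\<bar> \<le> (\<Sum>j\<in>{0..<n}. \<bar>A $$ (i, j)\<bar> * \<bar>vec_index v j\<bar>)"
      using sum_abs[of "\<lambda>j. A $$ (i, j) * vec_index v j" "{0..<n}"] by (simp add: abs_mult)
    also have "\<dots> \<le> (\<Sum>j\<in>{0..<n}. \<bar>A $$ (i, j)\<bar> * eucl_norm v)"
      using abs_index_le_eucl_norm[OF v] by (intro sum_mono mult_left_mono) auto
    finally show "\<bar>vec_index (A *\<^sub>v v) i\<bar> \<le> (\<Sum>j\<in>{0..<n}. \<bar>A $$ (i, j)\<bar>) * eucl_norm v"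
      by (simp add: sum_distrib_right)
  qed
  also have "\<dots> \<le> C * eucl_norm v"
    unfolding C_def by (simp add: sum_distrib_right distrib_right)
  finally show "eucl_norm (A *\<^sub>v v) \<le> C * eucl_norm v" .
qed

text \<open>Names the matrix that \<open>vec_differentiable_at\<close> hides under an existential
  quantifier, so that derivatives can be multiplied.\<close>

definition has_vec_derivative_at ::
    "nat \<Rightarrow> nat \<Rightarrow> (real vec \<Rightarrow> real vec) \<Rightarrow> real mat \<Rightarrow> real vec \<Rightarrow> bool" where
  "has_vec_derivative_at n m f A x \<longleftrightarrow>
     A \<in> carrier_mat m n \<and> (\<forall>\<epsilon>>0. \<exists>\<delta>>0. \<forall>y \<in> carrier_vec n.
        eucl_norm (y - x) < \<delta> \<longrightarrow>
        eucl_norm (f y - f x - A *\<^sub>v (y - x)) \<le> \<epsilon> * eucl_norm (y - x))"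

lemma vec_differentiable_at_iff:
  "vec_differentiable_at n m f x \<longleftrightarrow> (\<exists>A. has_vec_derivative_at n m f A x)"
  by (auto simp: vec_differentiable_at_def has_vec_derivative_at_def)

lemma has_vec_derivative_atD:
  assumes "has_vec_derivative_at n m f A x" "0 < \<epsilon>"
  obtains \<delta> where "0 < \<delta>"
    "\<And>y. y \<in> carrier_vec n \<Longrightarrow> eucl_norm (y - x) < \<delta> \<Longrightarrow>
       eucl_norm (f y - f x - A *\<^sub>v (y - x)) \<le> \<epsilon> * eucl_norm (y - x)"
  using assms unfolding has_vec_derivative_at_def by blast

text \<open>Approaching \<open>x\<close> along the line in direction \<open>unit_vec n c\<close>
  turns the estimate for the derivative into a difference quotient for each coordinate, whose limit
  is the entry of \<open>A\<close> in column \<open>c\<close>. In particular the derivative matrix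
  is unique.\<close>

lemma jacobian_eq_derivative:
  assumes der: "has_vec_derivative_at n m f A x"
    and f: "f \<in> carrier_vec n \<rightarrow> carrier_vec m" and x: "x \<in> carrier_vec n"
  shows "jacobian n m f x = A"
proof -
  have A: "A \<in> carrier_mat m n"
    using der by (simp add: has_vec_derivative_at_def)
  have "deriv (\<lambda>t. vec_index (f (x + t \<cdot>\<^sub>v unit_vec n c)) r) 0 = A $$ (r, c)"
    if r: "r < m" and c: "c < n" for r c
  proof (rule DERIV_imp_deriv)
    let ?y = "\<lambda>t. x + t \<cdot>\<^sub>v unit_vec n c"
    let ?g = "\<lambda>t. vec_index (f (?y t)) r"
    have y0: "?y 0 = x"
      using x by (intro eq_vecI) auto
    have y: "?y t \<in> carrier_vec n" for t
      using x by simp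
    have diff: "?y t - x = t \<cdot>\<^sub>v unit_vec n c" for t
      using x by (intro eq_vecI) auto
    have fy: "f (?y t) \<in> carrier_vec m" "f x \<in> carrier_vec m" for t
      using f x y by blast+
    have Ay: "vec_index (A *\<^sub>v (t \<cdot>\<^sub>v unit_vec n c)) r = t * A $$ (r, c)" for t
      using A r c by (simp add: mult_mat_vec)
    show "(?g has_real_derivative A $$ (r, c)) (at 0)"
      unfolding DERIV_def LIM_eq
    proof (intro allI impI)
      fix \<epsilon> :: real assume "0 < \<epsilon>"
      \<comment> \<open>Half of \<open>\<epsilon>\<close> turns the non-strict estimate of the
        definition into the strict one that the limit asks for, as \<open>h\<close> is
        nonzero.\<close>
      then obtain \<delta> where \<delta>: "0 < \<delta>"
        "\<And>y. y \<in> carrier_vec n \<Longrightarrow> eucl_norm (y - x) < \<delta> \<Longrightarrow>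
           eucl_norm (f y - f x - A *\<^sub>v (y - x)) \<le> \<epsilon> / 2 * eucl_norm (y - x)"
        using has_vec_derivative_atD[OF der, of "\<epsilon> / 2"] by auto
      have "\<bar>(?g (0 + h) - ?g 0) / h - A $$ (r, c)\<bar> < \<epsilon>" if h: "h \<noteq> 0" "\<bar>h\<bar> < \<delta>" for h
      proof -
        let ?d = "f (?y h) - f x - A *\<^sub>v (h \<cdot>\<^sub>v unit_vec n c)"
        have "?d \<in> carrier_vec m"
          using fy A by simp
        then have "\<bar>vec_index ?d r\<bar> \<le> eucl_norm ?d"
          using r by (rule abs_index_le_eucl_norm)
        also have "\<dots> \<le> \<epsilon> / 2 * \<bar>h\<bar>"
          using \<delta>(2)[OF y, of h] h eucl_norm_smult_unit_vec[OF c] by (simp add: diff)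
        also have "\<dots> < \<epsilon> * \<bar>h\<bar>"
          using h \<open>0 < \<epsilon>\<close> by simp
        also have "vec_index ?d r = ?g h - ?g 0 - h * A $$ (r, c)"
          unfolding y0 using fy A r Ay by simp
        also have "\<dots> = ((?g (0 + h) - ?g 0) / h - A $$ (r, c)) * h"
          using h by (simp add: field_simps)
        finally show ?thesis
          using h by (simp add: abs_mult)
      qed
      then show "\<exists>s>0. \<forall>h. h \<noteq> 0 \<and> norm (h - 0) < s \<longrightarrow>
          norm ((?g (0 + h) - ?g 0) / h - A $$ (r, c)) < \<epsilon>"
        using \<delta>(1) by auto
    qed
  qed
  then show ?thesis
    using A by (intro eq_matI) (auto simp: jacobian_def)
qed

lemma has_vec_derivative_at_jacobian:
  assumes "vec_differentiable_at n m f x"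
    and "f \<in> carrier_vec n \<rightarrow> carrier_vec m" "x \<in> carrier_vec n"
  shows "has_vec_derivative_at n m f (jacobian n m f x) x"
  using assms jacobian_eq_derivative by (metis vec_differentiable_at_iff)

text \<open>The error of the composition is the error of \<open>g\<close> at the increment
  \<open>f y - f x\<close>, plus \<open>B\<close> applied to the error of \<open>f\<close>. Each of
  the two is kept below half of the allowed error.\<close>

lemma has_vec_derivative_at_comp:
  assumes f: "has_vec_derivative_at n m f A x" and g: "has_vec_derivative_at m p g B (f x)"
    and fc: "f \<in> carrier_vec n \<rightarrow> carrier_vec m" and gc: "g \<in> carrier_vec m \<rightarrow> carrier_vec p"
    and x: "x \<in> carrier_vec n"
  shows "has_vec_derivative_at n p (g \<circ> f) (B * A) x"
proof -
  have A: "A \<in> carrier_mat m n" and B: "B \<in> carrier_mat p m"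
    using f g by (simp_all add: has_vec_derivative_at_def)
  obtain a where a: "0 < a" "\<And>v. v \<in> carrier_vec n \<Longrightarrow> eucl_norm (A *\<^sub>v v) \<le> a * eucl_norm v"
    using eucl_norm_mult_mat_vec_le[OF A] by blast
  obtain b where b: "0 < b" "\<And>v. v \<in> carrier_vec m \<Longrightarrow> eucl_norm (B *\<^sub>v v) \<le> b * eucl_norm v"
    using eucl_norm_mult_mat_vec_le[OF B] by blast
  have "\<exists>\<delta>>0. \<forall>y \<in> carrier_vec n. eucl_norm (y - x) < \<delta> \<longrightarrow>
      eucl_norm (g (f y) - g (f x) - B * A *\<^sub>v (y - x)) \<le> \<epsilon> * eucl_norm (y - x)"
    if "0 < \<epsilon>" for \<epsilon>
  proof -
    \<comment> \<open>\<open>\<gamma>\<close> is the tolerance for \<open>g\<close>, whose increment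
      has norm at most \<open>a + 1\<close> times that of \<open>y - x\<close>;
      \<open>\<eta>\<close> is the tolerance for \<open>f\<close>, whose error \<open>B\<close>
      magnifies by at most \<open>b\<close>. The bound \<open>\<eta> \<le> 1\<close> is what gives
      the factor \<open>a + 1\<close>.\<close>
    define \<gamma> where "\<gamma> = \<epsilon> / (2 * (a + 1))"
    define \<eta> where "\<eta> = min 1 (\<epsilon> / (2 * b))"
    have pos: "0 < \<gamma>" "0 < \<eta>"
      using a b that by (auto simp: \<gamma>_def \<eta>_def)
    obtain \<delta>1 where \<delta>1: "0 < \<delta>1" "\<And>y. y \<in> carrier_vec n \<Longrightarrow> eucl_norm (y - x) < \<delta>1 \<Longrightarrow>
        eucl_norm (f y - f x - A *\<^sub>v (y - x)) \<le> \<eta> * eucl_norm (y - x)"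
      using has_vec_derivative_atD[OF f pos(2)] by blast
    obtain \<delta>2 where \<delta>2: "0 < \<delta>2" "\<And>z. z \<in> carrier_vec m \<Longrightarrow> eucl_norm (z - f x) < \<delta>2 \<Longrightarrow>
        eucl_norm (g z - g (f x) - B *\<^sub>v (z - f x)) \<le> \<gamma> * eucl_norm (z - f x)"
      using has_vec_derivative_atD[OF g pos(1)] by blast
    \<comment> \<open>The second argument of the minimum forces \<open>f y\<close> to come within
      \<open>\<delta>2\<close> of \<open>f x\<close>.\<close>
    define \<delta> where "\<delta> = min \<delta>1 (\<delta>2 / (a + 1))"
    have "eucl_norm (g (f y) - g (f x) - B * A *\<^sub>v (y - x)) \<le> \<epsilon> * eucl_norm (y - x)"
      if y: "y \<in> carrier_vec n" and lt: "eucl_norm (y - x) < \<delta>" for y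
    proof -
      let ?h = "y - x" and ?k = "f y - f x"
      let ?r = "?k - A *\<^sub>v ?h" and ?s = "g (f y) - g (f x) - B *\<^sub>v ?k"
      have h: "?h \<in> carrier_vec n" and fy: "f y \<in> carrier_vec m" and fx: "f x \<in> carrier_vec m"
        using x y fc by auto
      then have gy: "g (f y) \<in> carrier_vec p" and gx: "g (f x) \<in> carrier_vec p"
        using gc by blast+
      have Ah: "A *\<^sub>v ?h \<in> carrier_vec m" and k: "?k \<in> carrier_vec m"
        using A h fy fx by auto
      have r: "?r \<in> carrier_vec m" and s: "?s \<in> carrier_vec p" and Br: "B *\<^sub>v ?r \<in> carrier_vec p"
        using Ah k gy gx B by auto
      have r_le: "eucl_norm ?r \<le> \<eta> * eucl_norm ?h"
        using \<delta>1(2)[OF y] lt by (simp add: \<delta>_def)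
      also have "\<dots> \<le> 1 * eucl_norm ?h"
        by (rule mult_right_mono) (simp_all add: \<eta>_def)
      finally have r_le1: "eucl_norm ?r \<le> eucl_norm ?h" by simp
      have "?k = ?r + A *\<^sub>v ?h"
        using A h fy fx by (intro eq_vecI) auto
      then have "eucl_norm ?k \<le> eucl_norm ?r + eucl_norm (A *\<^sub>v ?h)"
        using eucl_norm_add_le[OF r Ah] by simp
      also have "\<dots> \<le> (a + 1) * eucl_norm ?h"
        using r_le1 a(2)[OF h] by (simp add: distrib_right)
      finally have k_le: "eucl_norm ?k \<le> (a + 1) * eucl_norm ?h" .
      also have "(a + 1) * eucl_norm ?h < \<delta>2"
        using lt a(1) by (simp add: \<delta>_def pos_less_divide_eq mult.commute)
      finally have "eucl_norm ?s \<le> \<gamma> * eucl_norm ?k"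
        using \<delta>2(2)[OF fy] by simp
      also have "\<dots> \<le> \<gamma> * ((a + 1) * eucl_norm ?h)"
        using k_le pos by (intro mult_left_mono) auto
      also have "\<dots> = \<epsilon> / 2 * eucl_norm ?h"
        using a(1) by (simp add: \<gamma>_def field_simps)
      finally have s_le: "eucl_norm ?s \<le> \<epsilon> / 2 * eucl_norm ?h" .
      have "eucl_norm (B *\<^sub>v ?r) \<le> b * (\<eta> * eucl_norm ?h)"
        using b(2)[OF r] mult_left_mono[OF r_le, of b] b(1) by linarith
      also have "\<dots> = (b * \<eta>) * eucl_norm ?h"
        by simp
      also have "\<dots> \<le> \<epsilon> / 2 * eucl_norm ?h"
      proof (rule mult_right_mono)
        have "b * \<eta> \<le> b * (\<epsilon> / (2 * b))"
          using b(1) by (intro mult_left_mono) (auto simp: \<eta>_def)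
        then show "b * \<eta> \<le> \<epsilon> / 2"
          using b(1) by simp
      qed simp
      finally have Br_le: "eucl_norm (B *\<^sub>v ?r) \<le> \<epsilon> / 2 * eucl_norm ?h" .
      have "B *\<^sub>v ?r = B *\<^sub>v ?k - B *\<^sub>v (A *\<^sub>v ?h)"
        using B k Ah by (rule mult_minus_distrib_mat_vec)
      also have "B *\<^sub>v (A *\<^sub>v ?h) = B * A *\<^sub>v ?h"
        using A B h by simp
      finally have "g (f y) - g (f x) - B * A *\<^sub>v ?h = ?s + B *\<^sub>v ?r"
        using gy gx A B by (intro eq_vecI) auto
      then show ?thesis
        using eucl_norm_add_le[OF s Br] s_le Br_le by simp
    qed
    moreover have "0 < \<delta>"
      using \<delta>1(1) \<delta>2(1) a(1) by (simp add: \<delta>_def)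
    ultimately show ?thesis by blast
  qed
  then show ?thesis
    using A B by (simp add: has_vec_derivative_at_def)
qed

section \<open>Products along the chain\<close>

lemma chain_jacobian_self [simp]: "chain_jacobian J i i = J i"
  by (simp add: chain_jacobian.simps)

lemma chain_jacobian_Suc: "i \<le> j \<Longrightarrow> chain_jacobian J (Suc j) i = J (Suc j) * chain_jacobian J j i"
  by (simp add: chain_jacobian.simps[of J "Suc j"])

text \<open>Separates the combinatorics from the calculus: here the factors are any matrices of
  conformable dimensions.\<close>

locale jacobian_chain =
  fixes q :: nat and n m e :: "nat \<Rightarrow> nat" and J :: "nat \<Rightarrow> real mat"
  assumes dim_eq: "\<And>i. 1 \<le> i \<Longrightarrow> i < q \<Longrightarrow> m i = n (Suc i)"
    and J_carrier: "\<And>i. 1 \<le> i \<Longrightarrow> i \<le> q \<Longrightarrow> J i \<in> carrier_mat (m i) (n i)"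
begin

lemma chain_jacobian_carrier:
  assumes "1 \<le> i" "i \<le> j" "j \<le> q"
  shows "chain_jacobian J j i \<in> carrier_mat (m j) (n i)"
  using assms(2,3)
proof (induction j rule: dec_induct)
  case base
  then show ?case using assms J_carrier by simp
next
  case (step k)
  then show ?case
    using assms J_carrier[of "Suc k"] dim_eq[of k] by (simp add: chain_jacobian_Suc)
qed

text \<open>Associativity. The recursion peels factors off on the left, so the induction starts at
  \<open>j = Suc k\<close>, where the claim is one unfolding, and then adds left factors.\<close>

lemma chain_jacobian_split:
  assumes "1 \<le> i" "i \<le> k" "k < j" "j \<le> q"
  shows "chain_jacobian J j (Suc k) * chain_jacobian J k i = chain_jacobian J j i"
proof -
  have "Suc k \<le> j" using assms by simp
  then show ?thesis
    using assms(4)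
  proof (induction j rule: dec_induct)
    case base
    then show ?case using assms by (simp add: chain_jacobian_Suc)
  next
    case (step l)
    have "J (Suc l) \<in> carrier_mat (m (Suc l)) (m l)"
      using J_carrier[of "Suc l"] dim_eq[of l] step by simp
    moreover have "chain_jacobian J l (Suc k) \<in> carrier_mat (m l) (m k)"
      using chain_jacobian_carrier[of "Suc k" l] dim_eq[of k] assms step by simp
    moreover have "chain_jacobian J k i \<in> carrier_mat (m k) (n i)"
      using chain_jacobian_carrier[of i k] assms step by simp
    ultimately show ?case
      using step assms by (simp add: chain_jacobian_Suc)
  qed
qed

section \<open>The recurrence\<close>

text \<open>Each entry is read at the stage that fills its own diagonal, which frees the recurrence
  from the stage counter of the table.\<close>

definition opt_cost :: "nat \<Rightarrow> nat \<Rightarrow> nat" where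
  "opt_cost j i = fma_table n m e (j - i) j i"

text \<open>A later stage writes only its own diagonal, so a filled entry never changes.\<close>

lemma fma_table_eq_opt_cost:
  assumes "i \<le> j" "j - i \<le> d"
  shows "fma_table n m e d j i = opt_cost j i"
  using assms(2)
proof (induction d rule: dec_induct)
  case base
  then show ?case by (simp add: opt_cost_def)
next
  case (step d)
  then have "j \<noteq> i + Suc d" by linarith
  then show ?case using step.IH by simp
qed

lemma opt_cost_self: "opt_cost i i = e i * min (n i) (m i)"
  by (simp add: opt_cost_def)

definition split_costs :: "nat \<Rightarrow> nat \<Rightarrow> nat \<Rightarrow> nat set" where
  "split_costs j i k =
     {opt_cost j (k + 1) + opt_cost k i + m j * m k * n i,
      opt_cost j (k + 1) + m j * (\<Sum>\<nu>=i..k. e \<nu>),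
      opt_cost k i + n i * (\<Sum>\<nu>=k+1..j. e \<nu>)}"

lemma finite_split_costs [simp]: "finite (split_costs j i k)" "split_costs j i k \<noteq> {}"
  by (simp_all add: split_costs_def)

lemma opt_cost_rec:
  assumes "i < j"
  shows "opt_cost j i = (MIN k\<in>{i..<j}. Min (split_costs j i k))"
proof -
  obtain d where d: "j = i + Suc d"
    using assms less_iff_Suc_add by auto
  have "opt_cost j i = fma_table n m e (Suc d) j i"
    by (simp add: opt_cost_def d)
  also have "\<dots> = (MIN k\<in>{i..<j}. Min
         {fma_table n m e d j (k + 1) + fma_table n m e d k i + m j * m k * n i,
          fma_table n m e d j (k + 1) + m j * (\<Sum>\<nu>=i..k. e \<nu>),
          fma_table n m e d k i + n i * (\<Sum>\<nu>=k+1..j. e \<nu>)})"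
    using d by simp
  also have "\<dots> = (MIN k\<in>{i..<j}. Min (split_costs j i k))"
  proof (intro arg_cong[of _ _ Min] image_cong refl)
    \<comment> \<open>Both parts of the split are strictly shorter than
      \<open>j - i = Suc d\<close>, so their diagonals are filled at stage \<open>d\<close>.\<close>
    fix k assume "k \<in> {i..<j}"
    then have "fma_table n m e d j (k + 1) = opt_cost j (k + 1)"
        "fma_table n m e d k i = opt_cost k i"
      using d by (auto intro!: fma_table_eq_opt_cost)
    then show "{fma_table n m e d j (k + 1) + fma_table n m e d k i + m j * m k * n i,
          fma_table n m e d j (k + 1) + m j * (\<Sum>\<nu>=i..k. e \<nu>),
          fma_table n m e d k i + n i * (\<Sum>\<nu>=k+1..j. e \<nu>)} = split_costs j i k"
      by (simp only: split_costs_def)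
  qed
  finally show ?thesis .
qed

lemma opt_cost_le:
  assumes "i \<le> k" "k < j" "c \<in> split_costs j i k"
  shows "opt_cost j i \<le> c"
proof -
  have "opt_cost j i \<le> Min (split_costs j i k)"
    unfolding opt_cost_rec[OF le_less_trans[OF assms(1,2)]]
    using assms(1,2) by (intro Min_le) auto
  also have "\<dots> \<le> c"
    using assms by simp
  finally show ?thesis .
qed

lemma opt_cost_attained:
  assumes "i < j"
  obtains k where "i \<le> k" "k < j" "opt_cost j i \<in> split_costs j i k"
proof -
  have "opt_cost j i \<in> (\<lambda>k. Min (split_costs j i k)) ` {i..<j}"
    unfolding opt_cost_rec[OF assms] using assms by (intro Min_in) auto
  then obtain k where "i \<le> k" "k < j" "opt_cost j i = Min (split_costs j i k)"
    by auto
  then show ?thesis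
    using that Min_in[OF finite_split_costs] by simp
qed

section \<open>Evaluations\<close>

abbreviation "ev \<equiv> evaluation q n m e J"

text \<open>Tangent and adjoint extensions check only the end of the interval that they move; the
  remaining index bounds, and the correctness of the operand, are carried by this invariant.\<close>

definition valid_store :: "store \<Rightarrow> bool" where
  "valid_store s \<longleftrightarrow> (\<forall>j i A. s (j, i) = Some A \<longrightarrow>
     1 \<le> i \<and> i \<le> j \<and> j \<le> q \<and> A = chain_jacobian J j i)"

text \<open>
  \<open>W j i\<close> is the cost spent on accumulating products within \<open>F\<^sub>j \<circ> \<dots> \<circ> F\<^sub>i\<close>. It is
  superadditive because disjoint subchains cannot share a step, so reusing stored results never
  beats the recurrence.
\<close>

definition spends :: "nat \<Rightarrow> store \<Rightarrow> (nat \<Rightarrow> nat \<Rightarrow> nat) \<Rightarrow> bool" where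
  "spends c s W \<longleftrightarrow>
     (\<forall>j i. W j i \<le> c) \<and>
     (\<forall>i k j. i \<le> k \<and> k < j \<longrightarrow> W j (Suc k) + W k i \<le> W j i) \<and>
     (\<forall>j i. s (j, i) \<noteq> None \<longrightarrow> opt_cost j i \<le> W j i)"

text \<open>The new entry only has to be affordable by what was spent inside its own subchain
  together with the cost of the step that writes it.\<close>

lemma spends_step:
  assumes W: "spends c s W" and ab: "a \<le> b" and opt: "opt_cost b a \<le> W b a + d"
  shows "\<exists>W'. spends (c + d) (s((b, a) \<mapsto> A)) W'"
proof
  \<comment> \<open>The cost of the step is charged to every subchain that contains
    \<open>{a..b}\<close>.\<close>
  let ?W = "\<lambda>j i. W j i + (if i \<le> a \<and> b \<le> j then d else 0)"
  have "W j i \<le> c" for j i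
    using W by (simp add: spends_def)
  moreover have "?W j (Suc k) + ?W k i \<le> ?W j i" if "i \<le> k" "k < j" for i k j
  proof -
    have "W j (Suc k) + W k i \<le> W j i"
      using W that by (simp add: spends_def)
    \<comment> \<open>As \<open>a \<le> b\<close>, the interval \<open>{a..b}\<close> cannot lie in
      both halves of a split, so \<open>d\<close> is counted at most once on the left, and then also
      on the right.\<close>
    then show ?thesis
      using that ab by auto
  qed
  moreover have "opt_cost j i \<le> ?W j i" if "(s((b, a) \<mapsto> A)) (j, i) \<noteq> None" for j i
  proof (cases "(j, i) = (b, a)")
    case True
    then show ?thesis using opt by simp
  next
    case False
    then have "s (j, i) \<noteq> None" using that by (auto split: if_splits)
    then show ?thesis using W by (auto simp: spends_def trans_le_add1)
  qed
  ultimately show "spends (c + d) (s((b, a) \<mapsto> A)) ?W"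
    unfolding spends_def by (auto simp: trans_le_add1)
qed

lemma valid_store_upd:
  assumes "valid_store s" "1 \<le> i" "i \<le> j" "j \<le> q" "A = chain_jacobian J j i"
  shows "valid_store (s((j, i) \<mapsto> A))"
  using assms by (auto simp: valid_store_def)

text \<open>Every elementary step is an instance of a branch of the recurrence: identity steps are
  the diagonal case, extensions are the tangent and adjoint branches with a one-term sum, and the
  dense product is the first branch. The operands are paid for by the old \<open>W\<close>, and
  superadditivity transfers these payments to the subchain of the result.\<close>

lemma eval_step_invariant:
  assumes "eval_step q n m e J s d s'" and valid: "valid_store s" and W: "spends c s W"
  shows "valid_store s' \<and> (\<exists>W'. spends (c + d) s' W')"
  using assms(1)
proof cases
  case (tangent_identity i)
  have "J i * 1\<^sub>m (n i) = J i"
    using J_carrier[of i] tangent_identity by simp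
  moreover have "opt_cost i i \<le> W i i + d"
    using tangent_identity by (simp add: opt_cost_self mult.commute trans_le_add2)
  ultimately show ?thesis
    using valid_store_upd[OF valid, of i i "J i"] spends_step[OF W, of i i d] tangent_identity
    by (simp add: tangent_def)
next
  case (adjoint_identity i)
  have "1\<^sub>m (m i) * J i = J i"
    using J_carrier[of i] adjoint_identity by simp
  moreover have "opt_cost i i \<le> W i i + d"
    using adjoint_identity by (simp add: opt_cost_self mult.commute trans_le_add2)
  ultimately show ?thesis
    using valid_store_upd[OF valid, of i i "J i"] spends_step[OF W, of i i d] adjoint_identity
    by (simp add: adjoint_def)
next
  case (tangent_extend k i A)
  have ki: "1 \<le> i" "i \<le> k" "A = chain_jacobian J k i"
    using valid tangent_extend by (auto simp: valid_store_def)
  have "opt_cost (Suc k) i \<le> opt_cost k i + n i * e (Suc k)"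
    using ki by (intro opt_cost_le[of i k]) (auto simp: split_costs_def)
  moreover have "opt_cost k i \<le> W k i"
    using W tangent_extend by (auto simp: spends_def)
  \<comment> \<open>Superadditivity serves here as monotonicity: what was spent inside the shorter
    subchain counts for the longer one.\<close>
  moreover have "W (Suc k) (Suc k) + W k i \<le> W (Suc k) i"
    using W ki by (simp add: spends_def)
  ultimately have "opt_cost (Suc k) i \<le> W (Suc k) i + d"
    using tangent_extend by simp
  then show ?thesis
    using valid_store_upd[OF valid, of i "Suc k"] spends_step[OF W, of i "Suc k" d] ki tangent_extend
    by (simp add: tangent_def chain_jacobian_Suc)
next
  case (adjoint_extend j k A)
  have jk: "Suc k \<le> j" "j \<le> q" "A = chain_jacobian J j (Suc k)"
    using valid adjoint_extend by (auto simp: valid_store_def)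
  have "opt_cost j k \<le> opt_cost j (Suc k) + m j * e k"
    using jk by (intro opt_cost_le[of k k]) (auto simp: split_costs_def)
  moreover have "opt_cost j (Suc k) \<le> W j (Suc k)"
    using W adjoint_extend by (auto simp: spends_def)
  moreover have "W j (Suc k) + W k k \<le> W j k"
    using W jk by (simp add: spends_def)
  ultimately have "opt_cost j k \<le> W j k + d"
    using adjoint_extend by simp
  then show ?thesis
    using valid_store_upd[OF valid, of k j] spends_step[OF W, of k j d] jk adjoint_extend
      chain_jacobian_split[of k k j]
    by (simp add: adjoint_def)
next
  case (dense_product j k A i B)
  have jk: "j \<le> q" "A = chain_jacobian J j (Suc k)" "1 \<le> i" "B = chain_jacobian J k i"
    using valid dense_product by (auto simp: valid_store_def)
  have "opt_cost j i \<le> opt_cost j (Suc k) + opt_cost k i + m j * m k * n i"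
    using dense_product by (intro opt_cost_le[of i k]) (auto simp: split_costs_def)
  moreover have "opt_cost j (Suc k) \<le> W j (Suc k)" "opt_cost k i \<le> W k i"
    using W dense_product by (auto simp: spends_def)
  moreover have "W j (Suc k) + W k i \<le> W j i"
    using W dense_product by (simp add: spends_def)
  ultimately have "opt_cost j i \<le> W j i + d"
    using dense_product by simp
  then show ?thesis
    using valid_store_upd[OF valid, of i j] spends_step[OF W, of i j d] jk dense_product
      chain_jacobian_split[of i k j]
    by simp
qed

lemma evaluation_invariant:
  assumes "ev c s"
  shows "valid_store s \<and> (\<exists>W. spends c s W)"
  using assms
proof induction
  case start
  have "spends 0 Map.empty (\<lambda>_ _. 0)"
    by (simp add: spends_def)
  then show ?case by (auto simp: valid_store_def)
next
  case (step c s d s')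
  then show ?case using eval_step_invariant by blast
qed

lemma opt_cost_le_accumulates:
  assumes "accumulates q n m e J c j i A"
  shows "opt_cost j i \<le> c"
proof -
  obtain s where "ev c s" and s: "s (j, i) = Some A"
    using assms by (auto simp: accumulates_def)
  then obtain W where W: "spends c s W"
    using evaluation_invariant by blast
  then have "opt_cost j i \<le> W j i"
    using s by (simp add: spends_def)
  also have "W j i \<le> c"
    using W by (simp add: spends_def)
  finally show ?thesis .
qed

section \<open>Upper bound: evaluations that attain the recurrence\<close>

lemma evaluation_value:
  assumes "ev c s" "s (j, i) \<noteq> None"
  shows "s (j, i) = Some (chain_jacobian J j i)"
  using evaluation_invariant[OF assms(1)] assms(2) by (auto simp: valid_store_def)

text \<open>Realizes a sum in the recurrence by single tangent steps. Tracking domains suffices,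
  since \<open>evaluation_value\<close> determines every stored matrix; the empty sum at
  \<open>j = k\<close> starts the induction.\<close>

lemma evaluation_tangent_subchain:
  assumes "ev c s" "s (k, i) \<noteq> None" "k \<le> j" "j \<le> q"
  shows "\<exists>s'. ev (c + n i * (\<Sum>\<nu>=k+1..j. e \<nu>)) s' \<and> dom s \<subseteq> dom s' \<and> s' (j, i) \<noteq> None"
  using assms(3,4)
proof (induction j rule: dec_induct)
  case base
  then show ?case using assms by auto
next
  case (step l)
  then obtain s' A where s': "ev (c + n i * (\<Sum>\<nu>=k+1..l. e \<nu>)) s'" "dom s \<subseteq> dom s'"
      "s' (l, i) = Some A"
    by auto
  let ?t = "s'((Suc l, i) \<mapsto> tangent J (Suc l) A)"
  have eq: "c + n i * (\<Sum>\<nu>=k+1..l. e \<nu>) + n i * e (Suc l) = c + n i * (\<Sum>\<nu>=k+1..Suc l. e \<nu>)"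
    using step.hyps by (simp add: distrib_left)
  from evaluation.step[OF s'(1) tangent_extend[of s' l i A q n m e J]] s'(3) step.prems
  have "ev (c + n i * (\<Sum>\<nu>=k+1..l. e \<nu>) + n i * e (Suc l)) ?t"
    by simp
  then have "ev (c + n i * (\<Sum>\<nu>=k+1..Suc l. e \<nu>)) ?t"
    unfolding eq .
  moreover have "dom s \<subseteq> dom ?t" "?t (Suc l, i) \<noteq> None"
    using s'(2) by auto
  ultimately show ?case by blast
qed

text \<open>Mirror image of the tangent case. The induction runs downwards from
  \<open>i = Suc k\<close>, where the sum is empty.\<close>

lemma evaluation_adjoint_subchain:
  assumes "ev c s" "s (j, Suc k) \<noteq> None" "i \<le> Suc k" "1 \<le> i"
  shows "\<exists>s'. ev (c + m j * (\<Sum>\<nu>=i..k. e \<nu>)) s' \<and> dom s \<subseteq> dom s' \<and> s' (j, i) \<noteq> None"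
  using assms(3,4)
proof (induction i rule: inc_induct)
  case base
  then show ?case using assms by auto
next
  case (step l)
  then obtain s' A where s': "ev (c + m j * (\<Sum>\<nu>=Suc l..k. e \<nu>)) s'" "dom s \<subseteq> dom s'"
      "s' (j, Suc l) = Some A"
    by auto
  let ?t = "s'((j, l) \<mapsto> adjoint J l A)"
  have eq: "c + m j * (\<Sum>\<nu>=Suc l..k. e \<nu>) + m j * e l = c + m j * (\<Sum>\<nu>=l..k. e \<nu>)"
    using step.hyps by (simp add: sum.atLeast_Suc_atMost distrib_left)
  from evaluation.step[OF s'(1) adjoint_extend[of s' j l A q n m e J]] s'(3) step.prems
  have "ev (c + m j * (\<Sum>\<nu>=Suc l..k. e \<nu>) + m j * e l) ?t"
    by simp
  then have "ev (c + m j * (\<Sum>\<nu>=l..k. e \<nu>)) ?t"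
    unfolding eq .
  moreover have "dom s \<subseteq> dom ?t" "?t (j, l) \<noteq> None"
    using s'(2) by auto
  ultimately show ?case by blast
qed

text \<open>Starting from an arbitrary evaluation rather than the empty one lets the accumulations
  of two subchains be run one after the other, with the first result still available when the second
  is complete.\<close>

lemma evaluation_opt_cost:
  assumes "ev c s" "1 \<le> i" "i \<le> j" "j \<le> q"
  shows "\<exists>s'. ev (c + opt_cost j i) s' \<and> dom s \<subseteq> dom s' \<and> s' (j, i) \<noteq> None"
  using assms
proof (induction "j - i" arbitrary: c s i j rule: less_induct)
  case less
  show ?case
  proof (cases "i = j")
    case True
    have "opt_cost i i = n i * e i \<or> opt_cost i i = m i * e i"
      by (auto simp: opt_cost_self min_def)
    then obtain A where "eval_step q n m e J s (opt_cost i i) (s((i, i) \<mapsto> A))"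
      using tangent_identity[of i q n m e J s] adjoint_identity[of i q n m e J s] less.prems True
      by metis
    then have "ev (c + opt_cost j i) (s((j, i) \<mapsto> A))"
      using less.prems True by (blast intro: evaluation.step)
    moreover have "dom s \<subseteq> dom (s((j, i) \<mapsto> A))" "(s((j, i) \<mapsto> A)) (j, i) \<noteq> None"
      by auto
    ultimately show ?thesis by blast
  next
    case False
    then obtain k where k: "i \<le> k" "k < j" "opt_cost j i \<in> split_costs j i k"
      using opt_cost_attained less.prems by (metis le_neq_implies_less)
    have upper: "\<exists>s'. ev (c + opt_cost j (Suc k)) s' \<and> dom s \<subseteq> dom s' \<and> s' (j, Suc k) \<noteq> None"
      using k less.prems by (intro less.hyps) auto
    \<comment> \<open>Kept general in the starting evaluation: the product branch runs it after the
      upper part, the tangent branch at once.\<close>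
    have lower: "\<exists>s''. ev (c' + opt_cost k i) s'' \<and> dom s' \<subseteq> dom s'' \<and> s'' (k, i) \<noteq> None"
      if "ev c' s'" for c' s'
      using k less.prems that by (intro less.hyps) auto
    consider
        (product) "opt_cost j i = opt_cost j (Suc k) + opt_cost k i + m j * m k * n i"
      | (adjoint) "opt_cost j i = opt_cost j (Suc k) + m j * (\<Sum>\<nu>=i..k. e \<nu>)"
      | (tangent) "opt_cost j i = opt_cost k i + n i * (\<Sum>\<nu>=k+1..j. e \<nu>)"
      using k(3) by (auto simp: split_costs_def)
    then show ?thesis
    proof cases
      case product
      obtain s1 where s1: "ev (c + opt_cost j (Suc k)) s1" "dom s \<subseteq> dom s1" "s1 (j, Suc k) \<noteq> None"
        using upper by blast
      obtain s2 where s2: "ev (c + opt_cost j (Suc k) + opt_cost k i) s2" "dom s1 \<subseteq> dom s2"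
          "s2 (k, i) \<noteq> None"
        using lower[OF s1(1)] by blast
      obtain A B where AB: "s2 (j, Suc k) = Some A" "s2 (k, i) = Some B"
        using s1(3) s2(2,3) by blast
      from evaluation.step[OF s2(1) dense_product[of s2 j k A i B q n m e J]] AB k
      have "ev (c + opt_cost j i) (s2((j, i) \<mapsto> A * B))"
        by (simp add: product add.assoc)
      moreover have "dom s \<subseteq> dom (s2((j, i) \<mapsto> A * B))" "(s2((j, i) \<mapsto> A * B)) (j, i) \<noteq> None"
        using s1(2) s2(2) by auto
      ultimately show ?thesis by blast
    next
      case adjoint
      obtain s1 where s1: "ev (c + opt_cost j (Suc k)) s1" "dom s \<subseteq> dom s1" "s1 (j, Suc k) \<noteq> None"
        using upper by blast
      have "\<exists>s'. ev (c + opt_cost j i) s' \<and> dom s1 \<subseteq> dom s' \<and> s' (j, i) \<noteq> None"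
        unfolding adjoint add.assoc[symmetric]
        using k less.prems by (intro evaluation_adjoint_subchain[OF s1(1,3)]) auto
      then show ?thesis
        using s1(2) by blast
    next
      case tangent
      obtain s1 where s1: "ev (c + opt_cost k i) s1" "dom s \<subseteq> dom s1" "s1 (k, i) \<noteq> None"
        using lower[OF less.prems(1)] by blast
      have "\<exists>s'. ev (c + opt_cost j i) s' \<and> dom s1 \<subseteq> dom s' \<and> s' (j, i) \<noteq> None"
        unfolding tangent add.assoc[symmetric]
        using k less.prems by (intro evaluation_tangent_subchain[OF s1(1,3)]) auto
      then show ?thesis
        using s1(2) by blast
    qed
  qed
qed

lemma accumulates_opt_cost:
  assumes "1 \<le> i" "i \<le> j" "j \<le> q"
  shows "accumulates q n m e J (opt_cost j i) j i (chain_jacobian J j i)"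
  using evaluation_opt_cost[OF evaluation.start assms] evaluation_value
  unfolding accumulates_def by fastforce

section \<open>The minimum cost satisfies the recurrence\<close>

lemma fma_eq_opt_cost:
  assumes "1 \<le> i" "i \<le> j" "j \<le> q"
  shows "fma q n m e J j i = opt_cost j i"
  unfolding fma_def
  using accumulates_opt_cost[OF assms] opt_cost_le_accumulates by (rule Least_equality)

lemma fma_rec:
  assumes "1 \<le> i" "i \<le> j" "j \<le> q"
  shows "fma q n m e J j i =
    (if j = i then e j * min (n j) (m j)
     else (MIN k\<in>{i..<j}. Min
       {fma q n m e J j (k + 1) + fma q n m e J k i + m j * m k * n i,
        fma q n m e J j (k + 1) + m j * (\<Sum>\<nu>=i..k. e \<nu>),
        fma q n m e J k i + n i * (\<Sum>\<nu>=k+1..j. e \<nu>)}))"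
proof (cases "j = i")
  case True
  then show ?thesis using assms by (simp add: fma_eq_opt_cost opt_cost_self)
next
  case False
  have "opt_cost j i = (MIN k\<in>{i..<j}. Min
       {fma q n m e J j (k + 1) + fma q n m e J k i + m j * m k * n i,
        fma q n m e J j (k + 1) + m j * (\<Sum>\<nu>=i..k. e \<nu>),
        fma q n m e J k i + n i * (\<Sum>\<nu>=k+1..j. e \<nu>)})"
    unfolding opt_cost_rec[OF le_neq_implies_less[OF assms(2) False[symmetric]]]
    using assms by (intro arg_cong[of _ _ Min] image_cong refl)
      (simp add: split_costs_def fma_eq_opt_cost)
  then show ?thesis
    using False assms by (simp add: fma_eq_opt_cost)
qed

end

section \<open>The Jacobian of the composed map\<close>

lemma chain_map_carrier:
  assumes "\<And>i. 1 \<le> i \<Longrightarrow> i < q \<Longrightarrow> m i = n (Suc i)"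
    and "\<And>i. 1 \<le> i \<Longrightarrow> i \<le> q \<Longrightarrow> F i \<in> carrier_vec (n i) \<rightarrow> carrier_vec (m i)"
    and "1 \<le> k" "k \<le> q"
  shows "chain_map F k \<in> carrier_vec (n 1) \<rightarrow> carrier_vec (m k)"
  using assms(3,4)
proof (induction k rule: dec_induct)
  case base
  then show ?case using assms(2)[of 1] by simp
next
  case (step k)
  then have "chain_map F k \<in> carrier_vec (n 1) \<rightarrow> carrier_vec (n (Suc k))"
    using assms(1)[of k] by simp
  moreover have "F (Suc k) \<in> carrier_vec (n (Suc k)) \<rightarrow> carrier_vec (m (Suc k))"
    using assms(2)[of "Suc k"] step by simp
  ultimately show ?case by (auto simp: Pi_iff)
qed

text \<open>Iterated chain rule: \<open>local_jacobian\<close> at \<open>Suc k\<close> is taken at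
  \<open>chain_map F k x\<close>, exactly the point where the chain rule evaluates the outer
  derivative.\<close>

lemma chain_map_has_vec_derivative_at:
  assumes dim: "\<And>i. 1 \<le> i \<Longrightarrow> i < q \<Longrightarrow> m i = n (Suc i)"
    and F: "\<And>i. 1 \<le> i \<Longrightarrow> i \<le> q \<Longrightarrow> F i \<in> carrier_vec (n i) \<rightarrow> carrier_vec (m i)"
    and diff: "\<And>i y. 1 \<le> i \<Longrightarrow> i \<le> q \<Longrightarrow> y \<in> carrier_vec (n i) \<Longrightarrow>
      vec_differentiable_at (n i) (m i) (F i) y"
    and x: "x \<in> carrier_vec (n 1)" and k: "1 \<le> k" "k \<le> q"
  shows "has_vec_derivative_at (n 1) (m k) (chain_map F k)
    (chain_jacobian (local_jacobian n m F x) k 1) x"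
  using k
proof (induction k rule: dec_induct)
  case base
  then show ?case
    using has_vec_derivative_at_jacobian[OF diff F] x by (simp add: local_jacobian_def)
next
  case (step k)
  have mk: "m k = n (Suc k)"
    using dim step by simp
  have f: "chain_map F k \<in> carrier_vec (n 1) \<rightarrow> carrier_vec (m k)"
    using chain_map_carrier[of q m n F k] dim F step by simp
  then have "chain_map F k x \<in> carrier_vec (n (Suc k))"
    using x mk by auto
  then have "has_vec_derivative_at (m k) (m (Suc k)) (F (Suc k)) (local_jacobian n m F x (Suc k))
      (chain_map F k x)"
    using has_vec_derivative_at_jacobian[OF diff F, of "Suc k"] step mk
    by (simp add: local_jacobian_def)
  moreover have "F (Suc k) \<in> carrier_vec (m k) \<rightarrow> carrier_vec (m (Suc k))"
    using F[of "Suc k"] step mk by simp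
  moreover have "has_vec_derivative_at (n 1) (m k) (chain_map F k)
      (chain_jacobian (local_jacobian n m F x) k 1) x"
    using step by simp
  ultimately show ?case
    unfolding chain_map.simps chain_jacobian_Suc[OF step.hyps(1)]
    using f x by (blast intro: has_vec_derivative_at_comp)
qed

theorem theorem3p1:
  fixes q :: nat
    and n m e :: "nat \<Rightarrow> nat"
    and F :: "nat \<Rightarrow> real vec \<Rightarrow> real vec"
    and G :: "nat \<Rightarrow> 'v pair_pre_digraph"
    and J :: "nat \<Rightarrow> real mat"
    and x :: "real vec"
  assumes "q \<ge> 1"
    and "\<And>i. 1 \<le> i \<Longrightarrow> i \<le> q \<Longrightarrow> n i > 0 \<and> m i > 0"
    and "\<And>i. 1 \<le> i \<Longrightarrow> i < q \<Longrightarrow> m i = n (i + 1)"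
    and "\<And>i. 1 \<le> i \<Longrightarrow> i \<le> q \<Longrightarrow> F i \<in> carrier_vec (n i) \<rightarrow> carrier_vec (m i)"
    and "\<And>i y. 1 \<le> i \<Longrightarrow> i \<le> q \<Longrightarrow> y \<in> carrier_vec (n i) \<Longrightarrow>
           vec_differentiable_at (n i) (m i) (F i) y"
    and "\<And>i. 1 \<le> i \<Longrightarrow> i \<le> q \<Longrightarrow>
           pair_fin_digraph (G i) \<and> acyclic (parcs (G i)) \<and> parcs (G i) \<noteq> {}"
    and "e = (\<lambda>i. card (parcs (G i)))"
    and "x \<in> carrier_vec (n 1)"
    and "J = local_jacobian n m F x"
  shows
    "(\<forall>i j. 1 \<le> i \<and> i \<le> j \<and> j \<le> q \<longrightarrow>
        accumulates q n m e J (fma q n m e J j i) j i (chain_jacobian J j i) \<and>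
        fma q n m e J j i =
          (if j = i then e j * min (n j) (m j)
           else (MIN k\<in>{i..<j}. Min
             {fma q n m e J j (k + 1) + fma q n m e J k i + m j * m k * n i,
              fma q n m e J j (k + 1) + m j * (\<Sum>\<nu>=i..k. e \<nu>),
              fma q n m e J k i + n i * (\<Sum>\<nu>=k+1..j. e \<nu>)})))
     \<and> fma_table n m e (q - 1) q 1 = fma q n m e J q 1
     \<and> accumulates q n m e J (fma_table n m e (q - 1) q 1) q 1
         (jacobian (n 1) (m q) (chain_map F q) x)
     \<and> (\<forall>c. accumulates q n m e J c q 1 (jacobian (n 1) (m q) (chain_map F q) x) \<longrightarrow>
           fma_table n m e (q - 1) q 1 \<le> c)
     \<and> (\<forall>K>0. (\<exists>c<K. accumulates q n m e J c q 1 (jacobian (n 1) (m q) (chain_map F q) x))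
           \<longleftrightarrow> fma_table n m e (q - 1) q 1 < K)"
proof -
  interpret jacobian_chain q n m e J
    using assms(3) by unfold_locales (simp_all add: assms(9) local_jacobian_def jacobian_def)
  have jac: "jacobian (n 1) (m q) (chain_map F q) x = chain_jacobian J q 1"
    unfolding assms(9)
  proof (rule jacobian_eq_derivative)
    show "has_vec_derivative_at (n 1) (m q) (chain_map F q)
        (chain_jacobian (local_jacobian n m F x) q 1) x"
      using assms by (intro chain_map_has_vec_derivative_at[where q = q]) auto
    show "chain_map F q \<in> carrier_vec (n 1) \<rightarrow> carrier_vec (m q)"
      using assms by (intro chain_map_carrier[where q = q]) auto
  qed (use assms in simp)
  have table: "fma_table n m e (q - 1) q 1 = opt_cost q 1"
    by (simp add: opt_cost_def)
  have acc: "accumulates q n m e J (opt_cost q 1) q 1 (chain_jacobian J q 1)"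
    using assms(1) by (intro accumulates_opt_cost) auto
  show ?thesis
    unfolding jac table
  proof (intro conjI allI impI)
    fix i j assume ij: "1 \<le> i \<and> i \<le> j \<and> j \<le> q"
    show "accumulates q n m e J (fma q n m e J j i) j i (chain_jacobian J j i)"
      using ij accumulates_opt_cost fma_eq_opt_cost by simp
    show "fma q n m e J j i =
          (if j = i then e j * min (n j) (m j)
           else (MIN k\<in>{i..<j}. Min
             {fma q n m e J j (k + 1) + fma q n m e J k i + m j * m k * n i,
              fma q n m e J j (k + 1) + m j * (\<Sum>\<nu>=i..k. e \<nu>),
              fma q n m e J k i + n i * (\<Sum>\<nu>=k+1..j. e \<nu>)}))"
      using ij by (intro fma_rec) auto
  next
    show "opt_cost q 1 = fma q n m e J q 1"
      using assms(1) by (simp add: fma_eq_opt_cost)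
    show "accumulates q n m e J (opt_cost q 1) q 1 (chain_jacobian J q 1)"
      by (rule acc)
  next
    fix c assume "accumulates q n m e J c q 1 (chain_jacobian J q 1)"
    then show "opt_cost q 1 \<le> c"
      by (rule opt_cost_le_accumulates)
  next
    fix K :: nat
    \<comment> \<open>The optimal evaluation is the witness in one direction; the lower bound on
      every cost gives the other.\<close>
    show "(\<exists>c<K. accumulates q n m e J c q 1 (chain_jacobian J q 1)) \<longleftrightarrow> opt_cost q 1 < K"
      using acc opt_cost_le_accumulates le_less_trans by blast
  qed
qed

end
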